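(* Let $X$ be any one of $\mathbb{R}$, $\omega^\omega$, $2^\omega$ (with their usual topologies). Let $\kappa$ be a cardinal with $\omega\le\kappa<2^{\omega}$ and assume $MA_\kappa(\sigma\text{-centered})$. Then there exists a simple $\kappa$-fold cover of $X$ by closed sets which cannot be decomposed into two disjoint subcovers, i.e. there is a family $\mathcal H$ of closed subsets of $X$ such that every point of $X$ lies in at least $\kappa$ members of $\mathcal H$, but there is no partition $\mathcal H=\mathcal H_0\cup\mathcal H_1$, $\mathcal H_0\cap\mathcal H_1=\emptyset$, with $\bigcup\mathcal H_0=\bigcup\mathcal H_1=X$. Moreover, when $X=\mathbb{R}$, the cover can be chosen to consist of translates $K+t$ of a single compact set $K\subseteq\mathbb R$.
   Context: $MA_\kappa(\sigma\text{-centered})$ is Martin's Axiom for $\sigma$-centered posets and families of at most $\kappa$ dense sets: for every $\sigma$-centered poset $P$ and every family $\mathcal D$ of at most $\kappa$ dense subsets of $P$ there is a filter on $P$ meeting every member of $\mathcal D$. *)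

theory Defs
  imports "HOL-Analysis.Analysis"
begin

unbundle cardinal_syntax

section \<open>Martin's Axiom for sigma-centered posets\<close>

text \<open>
  A poset is a carrier \<open>A\<close> with a relation \<open>r\<close> such that \<open>partial_order_on A r\<close>, where
  \<open>(p, q) \<in> r\<close> means \<open>p \<le> q\<close>.  We follow the forcing convention that smaller conditions are
  stronger: dense sets are dense downwards and filters are upward closed and downward directed.
\<close>

definition dense_in_poset :: "'p set \<Rightarrow> 'p rel \<Rightarrow> 'p set \<Rightarrow> bool" where
  "dense_in_poset A r D \<longleftrightarrow> D \<subseteq> A \<and> (\<forall>p\<in>A. \<exists>d\<in>D. (d, p) \<in> r)"

definition poset_filter :: "'p set \<Rightarrow> 'p rel \<Rightarrow> 'p set \<Rightarrow> bool" where
  "poset_filter A r G \<longleftrightarrow>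
     G \<subseteq> A \<and> G \<noteq> {} \<and>
     (\<forall>p\<in>G. \<forall>q\<in>A. (p, q) \<in> r \<longrightarrow> q \<in> G) \<and>
     (\<forall>p\<in>G. \<forall>q\<in>G. \<exists>s\<in>G. (s, p) \<in> r \<and> (s, q) \<in> r)"

definition centered :: "'p set \<Rightarrow> 'p rel \<Rightarrow> 'p set \<Rightarrow> bool" where
  "centered A r C \<longleftrightarrow>
     C \<subseteq> A \<and> (\<forall>F. finite F \<and> F \<noteq> {} \<and> F \<subseteq> C \<longrightarrow> (\<exists>p\<in>A. \<forall>q\<in>F. (p, q) \<in> r))"

definition sigma_centered :: "'p set \<Rightarrow> 'p rel \<Rightarrow> bool" where
  "sigma_centered A r \<longleftrightarrow> (\<exists>C :: nat \<Rightarrow> 'p set. A = (\<Union>n. C n) \<and> (\<forall>n. centered A r (C n)))"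

text \<open>
  HOL cannot quantify over types inside a formula, so the axiom is stated for the posets whose
  carrier is a subset of a given type \<open>'p\<close>.  By \<open>MA_sigma_centered_transfer\<close> below, this is
  the unrestricted axiom as soon as \<open>'p\<close> has at least \<open>\<kappa>\<close> elements.
\<close>

definition MA_sigma_centered :: "'k rel \<Rightarrow> 'p itself \<Rightarrow> bool" where
  "MA_sigma_centered \<kappa> (_ :: 'p itself) \<longleftrightarrow>
     (\<forall>(A :: 'p set) r \<D>.
        A \<noteq> {} \<and> partial_order_on A r \<and> sigma_centered A r \<and>
        |\<D>| \<le>o \<kappa> \<and> (\<forall>D\<in>\<D>. dense_in_poset A r D) \<longrightarrow>
        (\<exists>G. poset_filter A r G \<and> (\<forall>D\<in>\<D>. G \<inter> D \<noteq> {})))"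

lemma card_of_lists_length_le:
  fixes \<kappa> :: "'k rel" and Q :: "'q set"
  assumes "Card_order \<kappa>" "\<not> finite (Field \<kappa>)" "|Q| \<le>o \<kappa>"
  shows "|{l. set l \<subseteq> Q \<and> length l = n}| \<le>o \<kappa>"
proof (induction n)
  case 0
  have "{l. set l \<subseteq> Q \<and> length l = 0} = {[] :: 'q list}" by auto
  moreover have "|{[] :: 'q list}| \<le>o \<kappa>"
    using assms(1,2) by (metis card_of_Field_ordIso card_of_singl_ordLeq finite.emptyI ordLeq_ordIso_trans)
  ultimately show ?case by simp
next
  case (Suc n)
  let ?L = "{l. set l \<subseteq> Q \<and> length l = n}"
  have "{l. set l \<subseteq> Q \<and> length l = Suc n} \<subseteq> (\<lambda>(x, l). x # l) ` (Q \<times> ?L)"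
    by (auto simp: length_Suc_conv)
  then have "|{l. set l \<subseteq> Q \<and> length l = Suc n}| \<le>o |Q \<times> ?L|"
    by (meson card_of_image card_of_mono1 ordLeq_transitive)
  also have "|Q \<times> ?L| \<le>o \<kappa>"
    using card_of_Times_ordLeq_infinite_Field assms Suc by blast
  finally show ?case .
qed

lemma MA_sigma_centered_transfer:
  fixes \<kappa> :: "'k rel"
  assumes card: "Card_order \<kappa>" and inf: "natLeq \<le>o \<kappa>"
    and le: "\<kappa> \<le>o |UNIV :: 'p set|"
    and MA: "MA_sigma_centered \<kappa> TYPE('p)"
  shows "MA_sigma_centered \<kappa> TYPE('q)"
  unfolding MA_sigma_centered_def
proof (intro allI impI, elim conjE)
  fix A :: "'q set" and r \<D>
  assume ne: "A \<noteq> {}" and po: "partial_order_on A r" and sc: "sigma_centered A r"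
    and D_card: "|\<D>| \<le>o \<kappa>" and dense: "\<forall>D\<in>\<D>. dense_in_poset A r D"
  have infin: "\<not> finite (Field \<kappa>)"
    using cinfinite_mono[OF inf natLeq_cinfinite] by (simp add: cinfinite_def)
  have refl: "(x, x) \<in> r" if "x \<in> A" for x
    using po that by (auto simp: partial_order_on_def preorder_on_def refl_on_def)
  have trans: "(x, z) \<in> r" if "(x, y) \<in> r" "(y, z) \<in> r" for x y z
    using po that by (auto simp: partial_order_on_def preorder_on_def dest: transD)
  have anti: "x = y" if "(x, y) \<in> r" "(y, x) \<in> r" for x y
    using po that by (auto simp: partial_order_on_def dest: antisymD)
  obtain a0 where a0: "a0 \<in> A" using ne by blast
  define low where "low l = (if \<exists>p\<in>A. \<forall>q\<in>set l. (p, q) \<in> r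
      then (SOME p. p \<in> A \<and> (\<forall>q\<in>set l. (p, q) \<in> r)) else a0)" for l
  have low: "low l \<in> A \<and> (\<forall>q\<in>set l. (low l, q) \<in> r)"
    if "\<exists>p\<in>A. \<forall>q\<in>set l. (p, q) \<in> r" for l
    using someI_ex[of "\<lambda>p. p \<in> A \<and> (\<forall>q\<in>set l. (p, q) \<in> r)"] that unfolding low_def by auto
  have low_A: "low l \<in> A" for l
    by (cases "\<exists>p\<in>A. \<forall>q\<in>set l. (p, q) \<in> r") (use low a0 in \<open>auto simp: low_def\<close>)
  define den where "den D p = (SOME d. d \<in> D \<and> (d, p) \<in> r)" for D p
  have den: "den D p \<in> D \<and> (den D p, p) \<in> r" if "D \<in> \<D>" "p \<in> A" for D p
  proof -
    have "\<exists>d. d \<in> D \<and> (d, p) \<in> r" using dense that unfolding dense_in_poset_def by blast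
    then show ?thesis unfolding den_def by (rule someI_ex)
  qed
  define S where "S Q = insert a0 (Q \<union> (\<Union>n. low ` {l. set l \<subseteq> Q \<and> length l = n})
      \<union> (\<Union>D\<in>\<D>. den D ` Q))" for Q
  define Qn where "Qn n = (S ^^ n) {}" for n
  define Q where "Q = (\<Union>n. Qn n)"
  have Un: "|X \<union> Y| \<le>o \<kappa>" if "|X| \<le>o \<kappa>" "|Y| \<le>o \<kappa>" for X Y :: "'q set"
    using card infin that by (simp add: card_of_Un_ordLeq_infinite_Field)
  have UN_nat: "|\<Union>n :: nat. X n| \<le>o \<kappa>" if "\<And>n. |X n| \<le>o \<kappa>" for X :: "nat \<Rightarrow> 'q set"
  proof (rule card_of_UNION_ordLeq_infinite_Field[OF infin card])
    show "|UNIV :: nat set| \<le>o \<kappa>"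
      using inf card_of_nat ordIso_ordLeq_trans by blast
  qed (use that in blast)
  have img: "|f ` X| \<le>o \<kappa>" if "|X| \<le>o \<kappa>" for f :: "'b \<Rightarrow> 'q" and X
    using that card_of_image ordLeq_transitive by blast
  have single: "|{x}| \<le>o \<kappa>" for x :: 'q
    using card infin by (metis card_of_Field_ordIso card_of_singl_ordLeq finite.emptyI ordLeq_ordIso_trans)
  have S_card: "|S Q'| \<le>o \<kappa>" if Q': "|Q'| \<le>o \<kappa>" for Q'
  proof -
    have 1: "|\<Union>n. low ` {l. set l \<subseteq> Q' \<and> length l = n}| \<le>o \<kappa>"
      by (intro UN_nat img card_of_lists_length_le card infin Q')
    have 2: "|\<Union>D\<in>\<D>. den D ` Q'| \<le>o \<kappa>"
      by (rule card_of_UNION_ordLeq_infinite_Field[OF infin card D_card]) (use img Q' in blast)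
    have "S Q' = {a0} \<union> ((Q' \<union> (\<Union>n. low ` {l. set l \<subseteq> Q' \<and> length l = n}))
      \<union> (\<Union>D\<in>\<D>. den D ` Q'))" by (simp add: S_def)
    then show ?thesis by (simp only:) (intro Un single 1 2 Q')
  qed
  have "|Qn n| \<le>o \<kappa>" for n
  proof (induction n)
    case 0 show ?case using card by (simp add: Qn_def card_of_empty1 card_order_on_well_order_on)
  next
    case (Suc n) then show ?case using S_card by (simp add: Qn_def)
  qed
  then have Q_card: "|Q| \<le>o \<kappa>" unfolding Q_def by (rule UN_nat)
  have Suc_sub: "Qn n \<subseteq> Qn (Suc n)" for n by (auto simp: Qn_def S_def)
  have mono: "Qn m \<subseteq> Qn n" if "m \<le> n" for m n
    using lift_Suc_mono_le[of Qn, OF Suc_sub that] .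
  have Qn_A: "Qn n \<subseteq> A" for n
  proof (induction n)
    case (Suc n)
    have "den D p \<in> A" if "D \<in> \<D>" "p \<in> Qn n" for D p
      using den[OF that(1)] dense that Suc unfolding dense_in_poset_def by blast
    then show ?case using Suc low_A a0 by (auto simp: Qn_def S_def)
  qed (simp add: Qn_def)
  have QA: "Q \<subseteq> A" using Qn_A by (auto simp: Q_def)
  have a0Q: "a0 \<in> Q" by (auto simp: Q_def Qn_def S_def intro!: exI[of _ 1])
  have denQ: "den D p \<in> Q" if D: "D \<in> \<D>" and p: "p \<in> Q" for D p
  proof -
    obtain n where "p \<in> Qn n" using p by (auto simp: Q_def)
    then have "den D p \<in> Qn (Suc n)" using D by (auto simp: Qn_def S_def)
    then show ?thesis by (auto simp: Q_def)
  qed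
  have lowQ: "low l \<in> Q" if "set l \<subseteq> Q" for l
  proof -
    have "\<exists>n. set l \<subseteq> Qn n" using that
    proof (induction l)
      case (Cons x l)
      then obtain n where n: "set l \<subseteq> Qn n" by auto
      obtain m where m: "x \<in> Qn m" using Cons.prems by (auto simp: Q_def)
      have "set (x # l) \<subseteq> Qn (max m n)"
        using n m mono[of n "max m n"] mono[of m "max m n"] by auto
      then show ?case by blast
    qed simp
    then obtain n where "set l \<subseteq> Qn n" by blast
    then have "low l \<in> Qn (Suc n)" by (auto simp: Qn_def S_def)
    then show ?thesis by (auto simp: Q_def)
  qed
  have "|Q| \<le>o |UNIV :: 'p set|" using Q_card le ordLeq_transitive by blast
  then obtain f :: "'q \<Rightarrow> 'p" where f: "inj_on f Q"
    by (auto simp: card_of_ordLeq[symmetric])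
  define B where "B = f ` Q"
  define s where "s = {(f x, f y) | x y. x \<in> Q \<and> y \<in> Q \<and> (x, y) \<in> r}"
  have s_iff: "(f x, f y) \<in> s \<longleftrightarrow> (x, y) \<in> r" if "x \<in> Q" "y \<in> Q" for x y
    using f that by (auto simp: s_def dest: inj_onD)
  have "partial_order_on B s"
    unfolding partial_order_on_def preorder_on_def
  proof (intro conjI)
    show "refl_on B s" using refl QA by (auto simp: refl_on_def B_def s_def)
    show "s \<subseteq> B \<times> B" by (auto simp: B_def s_def)
    show "trans s"
    proof (rule transI)
      fix x y z assume "(x, y) \<in> s" "(y, z) \<in> s"
      then obtain x' y' y'' z' where "x = f x'" "y = f y'" "y = f y''" "z = f z'"
        "x' \<in> Q" "y' \<in> Q" "y'' \<in> Q" "z' \<in> Q" "(x', y') \<in> r" "(y'', z') \<in> r"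
        unfolding s_def by blast
      moreover from this have "y' = y''" using f by (auto dest: inj_onD)
      ultimately show "(x, z) \<in> s" using trans s_iff by blast
    qed
    show "antisym s"
    proof (rule antisymI)
      fix x y assume xy: "(x, y) \<in> s" "(y, x) \<in> s"
      then obtain x' y' where "x = f x'" "y = f y'" "x' \<in> Q" "y' \<in> Q"
        unfolding s_def by blast
      then show "x = y" using anti s_iff xy by blast
    qed
  qed
  moreover have "sigma_centered B s"
  proof -
    obtain C :: "nat \<Rightarrow> 'q set"
      where C_all: "A = (\<Union>n. C n) \<and> (\<forall>n. centered A r (C n))"
      using sc unfolding sigma_centered_def by (elim exE)
    then have C: "A = (\<Union>n. C n)" "\<And>n. centered A r (C n)" by auto
    have "centered B s (f ` (C n \<inter> Q))" for n
      unfolding centered_def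
    proof (intro conjI allI impI, goal_cases)
      case 1 show ?case by (auto simp: B_def)
    next
      case (2 F)
      then obtain F' where F': "F' \<subseteq> C n \<inter> Q" "finite F'" "F = f ` F'"
        by (meson finite_subset_image)
      obtain l where l: "set l = F'" using F'(2) finite_list by blast
      have "F' \<noteq> {}" using 2 F' by auto
      then have "\<exists>p\<in>A. \<forall>q\<in>F'. (p, q) \<in> r"
        using C(2)[of n] F'(1,2) unfolding centered_def by simp
      then have "\<forall>q\<in>F'. (low l, q) \<in> r" using low l by blast
      moreover have "low l \<in> Q" using lowQ l F' by blast
      ultimately show ?case using F' s_iff by (auto simp: B_def intro!: bexI[of _ "low l"])
    qed
    moreover have "B = (\<Union>n. f ` (C n \<inter> Q))" using C(1) QA unfolding B_def by blast
    ultimately show ?thesis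
      unfolding sigma_centered_def by (intro exI[of _ "\<lambda>n. f ` (C n \<inter> Q)"]) simp
  qed
  moreover have "|(\<lambda>D. f ` (D \<inter> Q)) ` \<D>| \<le>o \<kappa>"
    using D_card card_of_image ordLeq_transitive by blast
  moreover have "dense_in_poset B s E" if E: "E \<in> (\<lambda>D. f ` (D \<inter> Q)) ` \<D>" for E
  proof -
    obtain D where D: "D \<in> \<D>" "E = f ` (D \<inter> Q)" using E by blast
    have "\<exists>d\<in>E. (d, f p) \<in> s" if "p \<in> Q" for p
      using den[OF D(1), of p] denQ[OF D(1) that] QA that s_iff D(2) by blast
    then show ?thesis using D by (auto simp: dense_in_poset_def B_def)
  qed
  moreover have "B \<noteq> {}" using a0Q by (auto simp: B_def)
  ultimately have hyps: "B \<noteq> {} \<and> partial_order_on B s \<and> sigma_centered B s \<and>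
      |(\<lambda>D. f ` (D \<inter> Q)) ` \<D>| \<le>o \<kappa> \<and>
      (\<forall>E\<in>(\<lambda>D. f ` (D \<inter> Q)) ` \<D>. dense_in_poset B s E)"
    by (intro conjI ballI)
  have "\<exists>G. poset_filter B s G \<and> (\<forall>E\<in>(\<lambda>D. f ` (D \<inter> Q)) ` \<D>. G \<inter> E \<noteq> {})"
    by (rule MA[unfolded MA_sigma_centered_def, rule_format, OF hyps])
  then obtain G where G: "poset_filter B s G" "\<forall>D\<in>\<D>. G \<inter> f ` (D \<inter> Q) \<noteq> {}"
    by (elim exE conjE) (simp only: ball_simps)
  define H where "H = {a \<in> A. \<exists>x\<in>Q. f x \<in> G \<and> (x, a) \<in> r}"
  have GB: "G \<subseteq> f ` Q" using G(1) by (auto simp: poset_filter_def B_def)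
  have "poset_filter A r H"
    unfolding poset_filter_def
  proof (intro conjI ballI impI)
    show "H \<subseteq> A" by (auto simp: H_def)
    have "G \<noteq> {}" using G(1) by (simp add: poset_filter_def)
    then obtain x where "x \<in> Q" "f x \<in> G" using GB by blast
    then show "H \<noteq> {}" using refl QA by (auto simp: H_def)
  next
    fix p q assume "p \<in> H" "q \<in> A" "(p, q) \<in> r"
    then show "q \<in> H" using trans by (auto simp: H_def)
  next
    fix p q assume "p \<in> H" "q \<in> H"
    then obtain x y where xy: "x \<in> Q" "f x \<in> G" "(x, p) \<in> r" "y \<in> Q" "f y \<in> G" "(y, q) \<in> r"
      by (auto simp: H_def)
    then obtain w where w: "w \<in> G" "(w, f x) \<in> s" "(w, f y) \<in> s"
      using G(1) unfolding poset_filter_def by meson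
    then obtain z where z: "z \<in> Q" "w = f z" using GB by blast
    then have "(z, x) \<in> r" "(z, y) \<in> r" using w xy s_iff by auto
    moreover have "z \<in> H" using z w refl QA by (auto simp: H_def)
    ultimately show "\<exists>z\<in>H. (z, p) \<in> r \<and> (z, q) \<in> r" using xy trans by blast
  qed
  moreover have "H \<inter> D \<noteq> {}" if "D \<in> \<D>" for D
  proof -
    have "G \<inter> f ` (D \<inter> Q) \<noteq> {}" using G(2) that by (rule bspec)
    then obtain x where "x \<in> D" "x \<in> Q" "f x \<in> G" by blast
    then show ?thesis using refl QA by (auto simp: H_def)
  qed
  ultimately show "\<exists>G. poset_filter A r G \<and> (\<forall>D\<in>\<D>. G \<inter> D \<noteq> {})"
    by (intro exI[of _ H] conjI ballI)
qed

section \<open>Simple covers and their decompositions\<close>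

text \<open>Covers are sets of sets, so no member is repeated: they are simple covers.\<close>

definition fold_cover :: "'k rel \<Rightarrow> 'a set set \<Rightarrow> bool" where
  "fold_cover \<kappa> \<H> \<longleftrightarrow> (\<forall>x. \<kappa> \<le>o |{H \<in> \<H>. x \<in> H}| )"

definition decomposable_cover :: "'a set set \<Rightarrow> bool" where
  "decomposable_cover \<H> \<longleftrightarrow>
     (\<exists>\<H>\<^sub>0 \<H>\<^sub>1. \<H> = \<H>\<^sub>0 \<union> \<H>\<^sub>1 \<and> \<H>\<^sub>0 \<inter> \<H>\<^sub>1 = {} \<and> \<Union>\<H>\<^sub>0 = UNIV \<and> \<Union>\<H>\<^sub>1 = UNIV)"

definition indecomposable_closed_fold_cover :: "'k rel \<Rightarrow> 'a::topological_space set set \<Rightarrow> bool" where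
  "indecomposable_closed_fold_cover \<kappa> \<H> \<longleftrightarrow>
     (\<forall>H\<in>\<H>. closed H) \<and> fold_cover \<kappa> \<H> \<and> \<not> decomposable_cover \<H>"

end

theory Submission
  imports Defs
begin

text \<open>
  Call the codes of the initial segments of a point of the Cantor space its branch; distinct points
  have almost disjoint branches.  Let \<open>Y\<close> consist of the points \<open>0\<^sup>n 1 f(\<xi>)\<close> for \<open>n \<in> \<omega>\<close> and
  \<open>\<xi> < \<kappa>\<close>, with \<open>f\<close> injective, and let \<open>F y\<close> be the closed set of all \<open>x \<subseteq> \<omega>\<close> that miss the branch
  of \<open>y\<close>.  In a 2-colouring of \<open>Y\<close>, one colour \<open>S\<close> occurs, for \<open>\<kappa>\<close> many \<open>\<xi>\<close>, at infinitely many
  \<open>n\<close>.  Forcing with pairs \<open>(s, F)\<close> of a finite \<open>s \<subseteq> \<omega>\<close> and a finite \<open>F \<subseteq> S\<close> whose branches miss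
  \<open>s\<close>, which is \<open>\<sigma>\<close>-centered, yields an \<open>x\<close> that meets the branch of every \<open>y \<in> Y - S\<close> and misses
  the branch of some \<open>0\<^sup>n 1 f(\<xi>)\<close> for each of those \<open>\<kappa>\<close> many \<open>\<xi>\<close>.  So \<open>x\<close> lies in \<open>\<kappa>\<close> many sets \<open>F y\<close>, all of the
  colour \<open>S\<close>.  Asking for one \<open>n\<close> per \<open>\<xi>\<close>, instead of deleting a finite part of \<open>x\<close>, makes the
  argument independent of the cofinality of \<open>\<kappa>\<close>.

  Let \<open>T\<close> be the set of the points that lie in \<open>\<kappa>\<close> many of the sets \<open>F y\<close>.  Adding closed sets that miss
  \<open>T\<close> and cover every other point \<open>\<kappa>\<close> times gives the cover.
\<close>

subsection \<open>An indecomposability criterion\<close>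

text \<open>At a point of \<open>T\<close> only sets \<open>F y\<close> are available, as the
  members of \<open>\<E>\<close> miss \<open>T\<close>. A decomposition colours \<open>Y\<close>
  according to the half containing \<open>F y\<close>; the point that \<open>mono\<close> gives for
  this colouring is then missed by one half. Injectivity of \<open>F\<close> lets indices be counted
  in place of members.\<close>

lemma indecomposable_closed_fold_coverI:
  fixes F :: "'y \<Rightarrow> 'x::topological_space set"
  assumes inj: "inj_on F Y"
    and F_closed: "\<And>y. y \<in> Y \<Longrightarrow> closed (F y)"
    and T_large: "\<And>x. x \<in> T \<Longrightarrow> \<kappa> \<le>o |{y \<in> Y. x \<in> F y}|"
    and mono: "\<And>S. S \<subseteq> Y \<Longrightarrow> \<exists>x\<in>T. {y \<in> Y. x \<in> F y} \<subseteq> S \<or> {y \<in> Y. x \<in> F y} \<subseteq> Y - S"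
    and E_closed: "\<And>E. E \<in> \<E> \<Longrightarrow> closed E"
    and E_T: "\<And>E. E \<in> \<E> \<Longrightarrow> E \<inter> T = {}"
    and E_large: "\<And>x. x \<notin> T \<Longrightarrow> \<kappa> \<le>o |{E \<in> \<E>. x \<in> E}|"
  shows "indecomposable_closed_fold_cover \<kappa> (F ` Y \<union> \<E>)"
  unfolding indecomposable_closed_fold_cover_def
proof (intro conjI)
  show "\<forall>H\<in>F ` Y \<union> \<E>. closed H" using F_closed E_closed by blast
  show "fold_cover \<kappa> (F ` Y \<union> \<E>)"
    unfolding fold_cover_def
  proof
    fix x
    show "\<kappa> \<le>o |{H \<in> F ` Y \<union> \<E>. x \<in> H}|"
    proof (cases "x \<in> T")
      case True
      have "|{y \<in> Y. x \<in> F y}| \<le>o |{H \<in> F ` Y \<union> \<E>. x \<in> H}|"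
        by (rule card_of_ordLeqI[of F]) (use inj in \<open>auto simp: inj_on_def\<close>)
      then show ?thesis using T_large[OF True] ordLeq_transitive by blast
    next
      case False
      have "|{E \<in> \<E>. x \<in> E}| \<le>o |{H \<in> F ` Y \<union> \<E>. x \<in> H}|"
        by (rule card_of_mono1) blast
      then show ?thesis using E_large[OF False] ordLeq_transitive by blast
    qed
  qed
  show "\<not> decomposable_cover (F ` Y \<union> \<E>)"
  proof
    assume "decomposable_cover (F ` Y \<union> \<E>)"
    then obtain \<H>0 \<H>1 where H: "F ` Y \<union> \<E> = \<H>0 \<union> \<H>1" "\<H>0 \<inter> \<H>1 = {}"
        "\<Union>\<H>0 = UNIV" "\<Union>\<H>1 = UNIV"
      unfolding decomposable_cover_def by (elim exE conjE)
    obtain x where x: "x \<in> T"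
        "{y \<in> Y. x \<in> F y} \<subseteq> {y \<in> Y. F y \<in> \<H>0} \<or> {y \<in> Y. x \<in> F y} \<subseteq> Y - {y \<in> Y. F y \<in> \<H>0}"
      using mono[of "{y \<in> Y. F y \<in> \<H>0}"] by auto
    have "x \<in> \<Union>\<H>0" "x \<in> \<Union>\<H>1" using H(3,4) by simp_all
    then obtain H0 H1 where H01: "H0 \<in> \<H>0" "x \<in> H0" "H1 \<in> \<H>1" "x \<in> H1"
      by (elim UnionE)
    have F: "H \<in> F ` Y" if "H \<in> \<H>0 \<union> \<H>1" "x \<in> H" for H
      using that x(1) E_T[of H] H(1) by auto
    obtain y0 y1 where y: "y0 \<in> Y" "H0 = F y0" "y1 \<in> Y" "H1 = F y1"
      using F[of H0] F[of H1] H01 by auto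
    have "F y1 \<notin> \<H>0" using H(2) H01(3) y by auto
    with x(2) show False using y H01 by auto
  qed
qed

subsection \<open>Almost disjoint branches\<close>

text \<open>
  The initial segments of \<open>y\<close> that are constantly False are left out of its branch, so the branch
  of \<open>spike n A\<close> leaves any given finite set as \<open>n\<close> grows.
\<close>

definition branch :: "(nat \<Rightarrow> bool) \<Rightarrow> nat set" where
  "branch y = {to_nat (map y [0..<k]) | k. \<exists>j<k. y j}"

definition spike :: "nat \<Rightarrow> nat set \<Rightarrow> nat \<Rightarrow> bool" where
  "spike n A i \<longleftrightarrow> i = n \<or> (n < i \<and> i - Suc n \<in> A)"

text \<open>Here \<open>x\<close> is the indicator function of a set of codes, so \<open>x\<close>
  and \<open>y\<close> range over the same Cantor space.\<close>

definition avoids :: "(nat \<Rightarrow> bool) \<Rightarrow> (nat \<Rightarrow> bool) \<Rightarrow> bool" where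
  "avoids x y \<longleftrightarrow> (\<forall>m\<in>branch y. \<not> x m)"

lemma spike_eq_iff: "spike n A = spike m B \<longleftrightarrow> n = m \<and> A = B"
proof
  assume eq: "spike n A = spike m B"
  have "spike n A n" "spike m B m" by (auto simp: spike_def)
  with eq have "spike m B n" "spike n A m" by simp_all
  then have nm: "n = m" by (auto simp: spike_def)
  have "i \<in> A \<longleftrightarrow> i \<in> B" for i
    using fun_cong[OF eq, of "Suc n + i"] nm by (simp add: spike_def)
  with nm show "n = m \<and> A = B" by blast
qed simp

lemma map_upt_eq_iff: "map y [0..<k] = map z [0..<l] \<longleftrightarrow> k = l \<and> (\<forall>i<k. y i = z i)"
  by (auto simp: list_eq_iff_nth_eq)

text \<open>An initial segment of \<open>y\<close> that contains a True and is long enough to differ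
  from every member of \<open>F\<close> has its code in no other of these branches.\<close>

lemma branch_diff_finite_nonempty:
  assumes "\<exists>j. y j" "finite F" "y \<notin> F"
  obtains m where "m \<in> branch y" "\<And>z. z \<in> F \<Longrightarrow> m \<notin> branch z"
proof -
  have "\<exists>i. y i \<noteq> z i" if "z \<in> F" for z
  proof -
    have "y \<noteq> z" using assms(3) that by blast
    then show ?thesis by (simp add: fun_eq_iff)
  qed
  then obtain d where d: "\<And>z. z \<in> F \<Longrightarrow> y (d z) \<noteq> z (d z)" by metis
  obtain j where j: "y j" using assms(1) by blast
  \<comment> \<open>The sum is a common bound for the finitely many places
    \<open>d z\<close>.\<close>
  define k where "k = Suc (j + (\<Sum>z\<in>F. d z))"
  have dk: "d z < k" if "z \<in> F" for z
    using member_le_sum[of z F d] that assms(2) by (simp add: k_def)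
  show ?thesis
  proof
    show "to_nat (map y [0..<k]) \<in> branch y"
      unfolding branch_def mem_Collect_eq using j by (intro exI[of _ k] exI[of _ j] conjI) (auto simp: k_def)
    show "to_nat (map y [0..<k]) \<notin> branch z" if "z \<in> F" for z
      using d[OF that] dk[OF that] by (auto simp: branch_def map_upt_eq_iff)
  qed
qed

text \<open>The singleton of a code in one branch but not in the other tells the two sets
  apart.\<close>

lemma inj_avoids:
  assumes "\<exists>j. y j" "\<exists>j. z j" "{x. avoids x y} = {x. avoids x z}"
  shows "y = z"
proof (rule ccontr)
  assume "y \<noteq> z"
  then obtain m where m: "m \<in> branch y" "m \<notin> branch z"
    using branch_diff_finite_nonempty[OF assms(1), of "{z}"] by auto
  have "avoids (\<lambda>i. i = m) z" using m by (auto simp: avoids_def)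
  moreover have "\<not> avoids (\<lambda>i. i = m) y" using m by (auto simp: avoids_def)
  ultimately show False using assms(3) by blast
qed

text \<open>A code in the branch of \<open>spike n A\<close> comes from a list longer than
  \<open>n\<close>, while the lists coded in \<open>s\<close> have bounded length.\<close>

lemma branch_spike_leaves_finite:
  assumes "finite s"
  obtains N where "\<And>n A. N \<le> n \<Longrightarrow> s \<inter> branch (spike n A) = {}"
proof -
  define N where "N = Suc (\<Sum>m\<in>s. length (from_nat m :: bool list))"
  have "s \<inter> branch (spike n A) = {}" if "N \<le> n" for n A
  proof (rule ccontr)
    assume "s \<inter> branch (spike n A) \<noteq> {}"
    then obtain k j where kj: "to_nat (map (spike n A) [0..<k]) \<in> s" "j < k" "spike n A j"
      by (auto simp: branch_def)
    from member_le_sum[OF kj(1), of "\<lambda>m. length (from_nat m :: bool list)"] assms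
    have "k < N" by (simp add: N_def)
    with kj that show False by (auto simp: spike_def)
  qed
  then show ?thesis using that by blast
qed

subsection \<open>The forcing argument\<close>

text \<open>The dense sets \<open>hit y\<close> confine the avoided points of \<open>Y\<close> to
  \<open>S\<close>; the dense sets \<open>cap \<xi>\<close> yield an avoided point for each index in
  \<open>E\<close>, and these points are distinct.\<close>

lemma MA_monochromatic_real:
  fixes \<kappa> :: "'k rel" and f :: "'k \<Rightarrow> nat set"
  assumes card: "Card_order \<kappa>" and inf: "natLeq \<le>o \<kappa>"
    and MA: "MA_sigma_centered \<kappa> TYPE(nat set \<times> (nat \<Rightarrow> bool) set)"
    and f: "inj_on f (Field \<kappa>)"
    and Y: "Y = {spike n (f \<xi>) | n \<xi>. \<xi> \<in> Field \<kappa>}"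
    and E: "E \<subseteq> Field \<kappa>" "\<kappa> \<le>o |E|"
    and often: "\<And>\<xi>. \<xi> \<in> E \<Longrightarrow> infinite {n. spike n (f \<xi>) \<in> S}"
  shows "\<exists>x. {y \<in> Y. avoids x y} \<subseteq> S \<and> \<kappa> \<le>o |{y \<in> Y. avoids x y}|"
proof -
  have infin: "\<not> finite (Field \<kappa>)"
    using cinfinite_mono[OF inf natLeq_cinfinite] by (simp add: cinfinite_def)
  have Fk: "|Field \<kappa>| \<le>o \<kappa>" using card card_of_Field_ordIso ordIso_iff_ordLeq by blast
  define A where "A = {(s, F). finite s \<and> finite F \<and> F \<subseteq> S \<and> (\<forall>y\<in>F. s \<inter> branch y = {})}"
  define r where "r = {(p, q). p \<in> A \<and> q \<in> A \<and> fst q \<subseteq> fst p \<and> snd q \<subseteq> snd p}"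
  define hit where "hit y = {(s, F) \<in> A. s \<inter> branch y \<noteq> {}}" for y
  define cap where "cap \<xi> = {(s, F) \<in> A. \<exists>n. spike n (f \<xi>) \<in> F}" for \<xi>
  define \<D> where "\<D> = hit ` (Y - S) \<union> cap ` E"
  have "({}, {}) \<in> A" by (simp add: A_def)
  then have "A \<noteq> {}" by blast
  moreover have "partial_order_on A r"
    unfolding partial_order_on_def preorder_on_def
    by (auto simp: r_def refl_on_def trans_def antisym_def prod_eq_iff)
  moreover have "sigma_centered A r"
    unfolding sigma_centered_def
  proof (intro exI conjI allI)
    \<comment> \<open>Conditions with equal first components are bounded by uniting their second
      components; lists enumerate the finite first components.\<close>
    let ?C = "\<lambda>n. {p \<in> A. fst p = set (from_nat n :: nat list)}"
    show "A = (\<Union>n. ?C n)"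
    proof (intro equalityI subsetI)
      fix p assume p: "p \<in> A"
      then have "finite (fst p)" by (auto simp: A_def)
      then obtain l where "set l = fst p" using finite_list by blast
      then have "p \<in> ?C (to_nat l)" using p by simp
      then show "p \<in> (\<Union>n. ?C n)" by blast
    qed auto
    show "centered A r (?C n)" for n
      unfolding centered_def
    proof (intro conjI allI impI)
      fix G assume G: "finite G \<and> G \<noteq> {} \<and> G \<subseteq> ?C n"
      let ?p = "(set (from_nat n :: nat list), \<Union>(snd ` G))"
      have fin: "finite (snd q)" "snd q \<subseteq> S" "\<forall>y\<in>snd q. set (from_nat n :: nat list) \<inter> branch y = {}"
        "fst q = set (from_nat n :: nat list)" "q \<in> A"
        if "q \<in> G" for q
      proof -
        have q: "q \<in> A" "fst q = set (from_nat n :: nat list)" using G that by auto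
        have "finite (snd q) \<and> snd q \<subseteq> S \<and> (\<forall>y\<in>snd q. fst q \<inter> branch y = {})"
          using q(1) unfolding A_def by (cases q) simp
        with q show "finite (snd q)" "snd q \<subseteq> S" "q \<in> A"
          "\<forall>y\<in>snd q. set (from_nat n :: nat list) \<inter> branch y = {}"
          "fst q = set (from_nat n :: nat list)" by simp_all
      qed
      have "finite (\<Union>(snd ` G))" using fin(1) G by blast
      moreover have "\<Union>(snd ` G) \<subseteq> S" using fin(2) by blast
      moreover have "\<forall>y\<in>\<Union>(snd ` G). set (from_nat n :: nat list) \<inter> branch y = {}"
        using fin(3) by blast
      ultimately have "?p \<in> A" by (simp add: A_def)
      moreover have "(?p, q) \<in> r" if "q \<in> G" for q
        using calculation fin(4,5)[OF that] that by (auto simp: r_def)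
      ultimately show "\<exists>p\<in>A. \<forall>q\<in>G. (p, q) \<in> r" by blast
    qed auto
  qed
  moreover have "|\<D>| \<le>o \<kappa>"
  proof -
    have "Y = (\<lambda>(n, \<xi>). spike n (f \<xi>)) ` (UNIV \<times> Field \<kappa>)" unfolding Y by auto
    moreover have "|UNIV \<times> Field \<kappa> :: (nat \<times> 'k) set| \<le>o \<kappa>"
    proof (rule card_of_Times_ordLeq_infinite_Field[OF infin _ Fk card])
      show "|UNIV :: nat set| \<le>o \<kappa>" using inf card_of_nat ordIso_ordLeq_trans by blast
    qed
    ultimately have "|Y| \<le>o \<kappa>" using ordLeq_transitive[OF card_of_image] by simp
    then have "|hit ` (Y - S)| \<le>o \<kappa>"
      using ordLeq_transitive[OF card_of_image ordLeq_transitive[OF card_of_mono1[OF Diff_subset]]]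
      by blast
    moreover have "|cap ` E| \<le>o \<kappa>"
      using ordLeq_transitive[OF card_of_image ordLeq_transitive[OF card_of_mono1[OF E(1)] Fk]] .
    ultimately show ?thesis unfolding \<D>_def
      by (rule card_of_Un_ordLeq_infinite_Field[OF infin _ _ card])
  qed
  moreover have "\<forall>D\<in>\<D>. dense_in_poset A r D"
  proof
    fix D assume "D \<in> \<D>"
    then consider y where "y \<in> Y - S" "D = hit y" | \<xi> where "\<xi> \<in> E" "D = cap \<xi>"
      by (auto simp: \<D>_def)
    then show "dense_in_poset A r D"
    proof cases
      case 1
      have "\<exists>d\<in>hit y. (d, p) \<in> r" if p: "p \<in> A" for p
      proof -
        obtain s F where sF: "p = (s, F)" by (cases p)
        with p have *: "finite s" "finite F" "F \<subseteq> S" "\<forall>y\<in>F. s \<inter> branch y = {}"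
          by (auto simp: A_def)
        have "\<exists>j. y j" using 1 by (auto simp: Y spike_def)
        \<comment> \<open>\<open>F\<close> lies in \<open>S\<close> and \<open>y\<close> does not,
          so \<open>y \<notin> F\<close>, and adding \<open>m\<close> to \<open>s\<close> respects
          the promises in \<open>F\<close>.\<close>
        then obtain m where m: "m \<in> branch y" "\<And>z. z \<in> F \<Longrightarrow> m \<notin> branch z"
          using branch_diff_finite_nonempty[of y F] * 1 by blast
        then have "(insert m s, F) \<in> A" using * by (auto simp: A_def)
        then have "(insert m s, F) \<in> hit y" "((insert m s, F), p) \<in> r"
          using m p sF by (auto simp: hit_def r_def)
        then show ?thesis by blast
      qed
      then show ?thesis using 1 by (auto simp: dense_in_poset_def hit_def)
    next
      case 2
      have "\<exists>d\<in>cap \<xi>. (d, p) \<in> r" if p: "p \<in> A" for p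
      proof -
        obtain s F where sF: "p = (s, F)" by (cases p)
        with p have *: "finite s" "finite F" "F \<subseteq> S" "\<forall>y\<in>F. s \<inter> branch y = {}"
          by (auto simp: A_def)
        obtain N where N: "\<And>n A. N \<le> n \<Longrightarrow> s \<inter> branch (spike n A) = {}"
          using branch_spike_leaves_finite[OF *(1)] by blast
        \<comment> \<open>Infinitely many \<open>n\<close> have the right colour, so one is large
          enough for \<open>s\<close> to miss the new branch already.\<close>
        obtain n where n: "N \<le> n" "spike n (f \<xi>) \<in> S"
          using often[OF 2(1)] by (auto simp: infinite_nat_iff_unbounded_le)
        let ?q = "(s, insert (spike n (f \<xi>)) F)"
        have "?q \<in> A" using * n N by (auto simp: A_def)
        then have "?q \<in> cap \<xi>" "(?q, p) \<in> r" using p sF by (auto simp: cap_def r_def)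
        then show ?thesis by blast
      qed
      then show ?thesis using 2 by (auto simp: dense_in_poset_def cap_def)
    qed
  qed
  ultimately have "\<exists>G. poset_filter A r G \<and> (\<forall>D\<in>\<D>. G \<inter> D \<noteq> {})"
    by (intro MA[unfolded MA_sigma_centered_def, THEN spec, THEN spec, THEN spec, THEN mp] conjI)
  then obtain G where G: "poset_filter A r G" and meet: "\<forall>D\<in>\<D>. G \<inter> D \<noteq> {}"
    by (elim exE conjE)
  define x where "x m \<longleftrightarrow> (\<exists>p\<in>G. m \<in> fst p)" for m
  have avoid: "avoids x y" if p: "p \<in> G" "y \<in> snd p" for p y
    unfolding avoids_def
  proof (intro ballI notI)
    fix m assume m: "m \<in> branch y" "x m"
    then obtain q where q: "q \<in> G" "m \<in> fst q" by (auto simp: x_def)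
    \<comment> \<open>A common extension of \<open>p\<close> and \<open>q\<close> would have
      \<open>m\<close> in its first component and promise to avoid the branch of
      \<open>y\<close>.\<close>
    then obtain u where u: "u \<in> G" "(u, p) \<in> r" "(u, q) \<in> r"
      using G p(1) unfolding poset_filter_def by meson
    then have "m \<in> fst u" "y \<in> snd u" "u \<in> A" using q p by (auto simp: r_def)
    with m show False unfolding A_def by (cases u) auto
  qed
  have "y \<in> S" if y: "y \<in> Y" "avoids x y" for y
  proof (rule ccontr)
    assume "y \<notin> S"
    with y have "hit y \<in> \<D>" by (auto simp: \<D>_def)
    then obtain p where p: "p \<in> G" "p \<in> hit y" using meet by blast
    then obtain m where "m \<in> fst p" "m \<in> branch y" by (cases p) (auto simp: hit_def)
    then show False using y(2) p(1) by (auto simp: avoids_def x_def)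
  qed
  moreover have "\<exists>n. avoids x (spike n (f \<xi>))" if "\<xi> \<in> E" for \<xi>
  proof -
    have "cap \<xi> \<in> \<D>" using that by (auto simp: \<D>_def)
    then obtain p where p: "p \<in> G" "p \<in> cap \<xi>" using meet by blast
    then obtain n where "spike n (f \<xi>) \<in> snd p" by (auto simp: cap_def)
    then show ?thesis using avoid[OF p(1)] by blast
  qed
  then obtain n where n: "\<And>\<xi>. \<xi> \<in> E \<Longrightarrow> avoids x (spike (n \<xi>) (f \<xi>))" by metis
  have "|E| \<le>o |{y \<in> Y. avoids x y}|"
  proof (rule card_of_ordLeqI[of "\<lambda>\<xi>. spike (n \<xi>) (f \<xi>)"])
    show "inj_on (\<lambda>\<xi>. spike (n \<xi>) (f \<xi>)) E"
      using f E(1) by (auto simp: inj_on_def spike_eq_iff)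
    show "spike (n \<xi>) (f \<xi>) \<in> {y \<in> Y. avoids x y}" if "\<xi> \<in> E" for \<xi>
      using n[OF that] that E(1) Y by auto
  qed
  then have "\<kappa> \<le>o |{y \<in> Y. avoids x y}|" using E(2) ordLeq_transitive by blast
  ultimately show ?thesis by blast
qed

text \<open>The indices at which \<open>S\<close> or its complement in \<open>Y\<close> recurs
  infinitely often exhaust \<open>Field \<kappa>\<close>. Two sets smaller than an infinite cardinal
  cannot do so, hence one colour is fit for the forcing argument.\<close>

lemma MA_avoids_unsplittable:
  fixes \<kappa> :: "'k rel"
  assumes card: "Card_order \<kappa>" and inf: "natLeq \<le>o \<kappa>"
    and le: "\<kappa> \<le>o |UNIV :: nat set set|"
    and MA: "MA_sigma_centered \<kappa> TYPE(nat set)"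
  obtains Y where "\<And>y. y \<in> Y \<Longrightarrow> \<exists>j. y j"
    and "\<And>S. S \<subseteq> Y \<Longrightarrow> \<exists>x. \<kappa> \<le>o |{y \<in> Y. avoids x y}| \<and>
      ({y \<in> Y. avoids x y} \<subseteq> S \<or> {y \<in> Y. avoids x y} \<subseteq> Y - S)"
proof -
  \<comment> \<open>The conditions live in a type other than \<open>nat set\<close>; the axiom
    passes to it because \<open>nat set\<close> has at least \<open>\<kappa>\<close>
    elements.\<close>
  have MA': "MA_sigma_centered \<kappa> TYPE(nat set \<times> (nat \<Rightarrow> bool) set)"
    using MA_sigma_centered_transfer[OF card inf le MA] .
  have infin: "\<not> finite (Field \<kappa>)"
    using cinfinite_mono[OF inf natLeq_cinfinite] by (simp add: cinfinite_def)
  have Fk: "( |Field \<kappa>|, \<kappa>) \<in> ordIso" using card card_of_Field_ordIso by blast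
  then have "|Field \<kappa>| \<le>o |UNIV :: nat set set|" using le ordIso_ordLeq_trans by blast
  then obtain f :: "'k \<Rightarrow> nat set" where f: "inj_on f (Field \<kappa>)"
    by (auto simp: card_of_ordLeq[symmetric])
  define Y where "Y = {spike n (f \<xi>) | n \<xi>. \<xi> \<in> Field \<kappa>}"
  show ?thesis
  proof (rule that[of Y])
    show "\<exists>j. y j" if "y \<in> Y" for y using that by (auto simp: Y_def spike_def)
    fix S assume "S \<subseteq> Y"
    define E where "E S' = {\<xi> \<in> Field \<kappa>. infinite {n. spike n (f \<xi>) \<in> S'}}" for S'
    have *: "\<exists>x. {y \<in> Y. avoids x y} \<subseteq> S' \<and> \<kappa> \<le>o |{y \<in> Y. avoids x y}|"
      if "\<kappa> \<le>o |E S'|" for S'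
      by (rule MA_monochromatic_real[OF card inf MA' f Y_def _ that]) (auto simp: E_def)
    have "\<xi> \<in> E S \<union> E (Y - S)" if "\<xi> \<in> Field \<kappa>" for \<xi>
    proof -
      have "{n. spike n (f \<xi>) \<in> S} \<union> {n. spike n (f \<xi>) \<in> Y - S} = UNIV"
        using that by (auto simp: Y_def)
      then have "infinite {n. spike n (f \<xi>) \<in> S} \<or> infinite {n. spike n (f \<xi>) \<in> Y - S}"
        by (metis finite_UnI infinite_UNIV_nat)
      then show ?thesis using that by (auto simp: E_def)
    qed
    then have un: "E S \<union> E (Y - S) = Field \<kappa>" by (auto simp: E_def)
    have "\<kappa> \<le>o |E S| \<or> \<kappa> \<le>o |E (Y - S)|"
    proof (rule ccontr)
      assume "\<not> ?thesis"
      then have "|E S| <o \<kappa>" "|E (Y - S)| <o \<kappa>"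
        using card by (meson card_of_Well_order card_order_on_well_order_on not_ordLeq_iff_ordLess)+
      then have "|E S \<union> E (Y - S)| <o \<kappa>"
        using card_of_Un_ordLess_infinite_Field[OF infin card] by blast
      then show False using un Fk not_ordLess_ordIso by metis
    qed
    then show "\<exists>x. \<kappa> \<le>o |{y \<in> Y. avoids x y}| \<and>
      ({y \<in> Y. avoids x y} \<subseteq> S \<or> {y \<in> Y. avoids x y} \<subseteq> Y - S)"
      using *[of S] *[of "Y - S"] by blast
  qed
qed

subsection \<open>Base 64 expansions\<close>

text \<open>An embedding of the Cantor space in the reals, with a base so large that sums with
  several coefficients can still be decoded digit by digit.\<close>

definition expand :: "(nat \<Rightarrow> bool) \<Rightarrow> real" where
  "expand x = (\<Sum>i. of_bool (x i) / 64 ^ i)"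

lemma summable_inverse_64_power: "summable (\<lambda>i. 1 / 64 ^ i :: real)"
  using summable_geometric[of "1/64 :: real"] by (simp add: power_one_over)

lemma expand_sums: "(\<lambda>i. of_bool (x i) / 64 ^ i) sums expand x"
  unfolding expand_def
  by (intro summable_sums summable_comparison_test'[OF summable_inverse_64_power, of 0])
    (simp add: divide_right_mono)

lemma expand_False [simp]: "expand (\<lambda>_. False) = 0"
  by (simp add: expand_def)

lemma continuous_on_coordinate:
  fixes g :: "bool \<Rightarrow> 'b::topological_space"
  shows "continuous_on UNIV (\<lambda>x :: nat \<Rightarrow> bool. g (x i))"
  using continuous_on_compose2[of UNIV g UNIV "\<lambda>x. x i"] by simp

lemma continuous_on_expand: "continuous_on UNIV expand"
proof (rule uniform_limit_theorem)
  show "uniform_limit UNIV (\<lambda>n x. \<Sum>i<n. of_bool (x i) / 64 ^ i) expand sequentially"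
    unfolding expand_def
    by (rule Weierstrass_m_test[OF _ summable_inverse_64_power]) (simp add: divide_right_mono)
  show "\<forall>\<^sub>F n in sequentially. continuous_on UNIV (\<lambda>x. \<Sum>i<n. of_bool (x i) / (64 ^ i :: real))"
    by (intro always_eventually allI continuous_on_sum continuous_on_coordinate)
qed simp

text \<open>Once the earlier digits vanish, the integer \<open>d i\<close> is minus the tail, whose
  absolute value is at most 62/63 and so less than 1.\<close>

lemma digits_eq_zero:
  fixes d :: "nat \<Rightarrow> int"
  assumes "(\<lambda>i. of_int (d i) / 64 ^ i :: real) sums 0" and bound: "\<And>i. \<bar>d i\<bar> \<le> 62"
  shows "d i = 0"
proof (induction i rule: less_induct)
  case (less i)
  have "(\<lambda>n. of_int (d (n + i)) / 64 ^ (n + i) :: real) sums (0 - (\<Sum>j<i. of_int (d j) / 64 ^ j))"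
    by (rule sums_split_initial_segment[OF assms(1)])
  then have "(\<lambda>n. of_int (d (n + i)) / 64 ^ (n + i) :: real) sums 0"
    using less by simp
  then have "(\<lambda>n. 64 ^ i * (of_int (d (n + i)) / 64 ^ (n + i)) :: real) sums (64 ^ i * 0)"
    by (rule sums_mult)
  then have "(\<lambda>n. of_int (d (n + i)) / 64 ^ n :: real) sums 0"
    by (simp add: power_add)
  then have tail: "(\<lambda>n. of_int (d (Suc n + i)) / 64 ^ Suc n :: real) sums - of_int (d i)"
    by (subst sums_Suc_iff) simp
  have geo: "(\<lambda>n. 62 / 64 ^ Suc n :: real) sums (62 / 63)"
    using sums_mult[OF geometric_sums[of "1/64 :: real"], of "62/64"]
    by (simp add: power_one_over field_simps)
  have bnd: "\<bar>of_int (d (Suc n + i))\<bar> \<le> (62 :: real)" for n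
    using bound[of "Suc n + i"] by linarith
  have "- of_int (d i) \<le> (62 / 63 :: real)"
    proof (rule sums_le[OF _ tail geo])
    fix n
    have "(of_int (d (Suc n + i)) :: real) \<le> 62" using bnd[of n] by linarith
    then show "(of_int (d (Suc n + i)) / 64 ^ Suc n :: real) \<le> 62 / 64 ^ Suc n"
      by (rule divide_right_mono) simp
  qed
  moreover have "- (62 / 63) \<le> - (of_int (d i) :: real)"
  proof (rule sums_le[OF _ sums_minus[OF geo] tail])
    fix n
    have "- 62 \<le> (of_int (d (Suc n + i)) :: real)" using bnd[of n] by linarith
    then show "- (62 / 64 ^ Suc n) \<le> (of_int (d (Suc n + i)) / 64 ^ Suc n :: real)"
      using divide_right_mono[of "- 62" _ "64 ^ Suc n :: real"] by simp
  qed
  ultimately show ?case by linarith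
qed

text \<open>The digits of either side lie between -17 and 21, so their differences are within the
  bound of \<open>digits_eq_zero\<close>.\<close>

lemma expand_combination_digits:
  assumes "expand p - expand u + 4 * expand y + 16 * expand v - 16 * expand w =
    expand p' - expand u' + 4 * expand y' + 16 * expand v' - 16 * expand w'"
  shows "of_bool (p i) - of_bool (u i) + 4 * of_bool (y i) + 16 * of_bool (v i) - 16 * of_bool (w i) =
    (of_bool (p' i) - of_bool (u' i) + 4 * of_bool (y' i) + 16 * of_bool (v' i) - 16 * of_bool (w' i) :: int)"
proof -
  define c where "c p u y v w = (\<lambda>i. of_bool (p i) - of_bool (u i) + 4 * of_bool (y i)
    + 16 * of_bool (v i) - 16 * of_bool (w i) :: int)" for p u y v w :: "nat \<Rightarrow> bool"
  have sums: "(\<lambda>i. of_int (c p u y v w i) / 64 ^ i :: real) sums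
      (expand p - expand u + 4 * expand y + 16 * expand v - 16 * expand w)" for p u y v w
  proof -
    have "(\<lambda>i. of_bool (p i) / 64 ^ i - of_bool (u i) / 64 ^ i + 4 * (of_bool (y i) / 64 ^ i)
        + 16 * (of_bool (v i) / 64 ^ i) - 16 * (of_bool (w i) / 64 ^ i) :: real) sums
      (expand p - expand u + 4 * expand y + 16 * expand v - 16 * expand w)"
      by (intro sums_add sums_diff sums_mult expand_sums)
    then show ?thesis by (simp add: c_def add_divide_distrib diff_divide_distrib)
  qed
  have bit: "0 \<le> (of_bool b :: int)" "of_bool b \<le> (1 :: int)" for b by simp_all
  have bound: "- 17 \<le> c p u y v w i" "c p u y v w i \<le> 21" for p u y v w i
    using bit[of "p i"] bit[of "u i"] bit[of "y i"] bit[of "v i"] bit[of "w i"]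
    unfolding c_def by linarith+
  have "c p u y v w i - c p' u' y' v' w' i = 0"
  proof (rule digits_eq_zero)
    show "(\<lambda>i. of_int (c p u y v w i - c p' u' y' v' w' i) / 64 ^ i :: real) sums 0"
      using sums_diff[OF sums[of p u y v w] sums[of p' u' y' v' w']] assms
      by (simp add: diff_divide_distrib)
    show "\<bar>c p u y v w i - c p' u' y' v' w' i\<bar> \<le> 62" for i
      using bound[of p u y v w i] bound[of p' u' y' v' w' i] by linarith
  qed
  then show ?thesis by (simp add: c_def)
qed

lemma inj_expand: "inj expand"
proof (rule injI)
  fix x y assume "expand x = expand y"
  then have "x i = y i" for i
    using expand_combination_digits[of x "\<lambda>_. False" "\<lambda>_. False" "\<lambda>_. False" "\<lambda>_. False"
        y "\<lambda>_. False" "\<lambda>_. False" "\<lambda>_. False" "\<lambda>_. False" i]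
    by (simp add: of_bool_def split: if_splits)
  then show "x = y" by (rule ext)
qed

subsection \<open>Compactness\<close>

lemma compact_UNIV_Cantor: "compact (UNIV :: (nat \<Rightarrow> bool) set)"
proof -
  have "compact_space (product_topology (\<lambda>_ :: nat. euclidean :: bool topology) UNIV)"
    unfolding compact_space_product_topology
    by (simp add: compact_space_def finite_imp_compact)
  then show ?thesis by (simp add: euclidean_product_topology compact_space_def)
qed

text \<open>Each clause says that \<open>l\<close> is no initial segment of \<open>y\<close> or that
  its code is not in \<open>x\<close>. It is a finite disjunction of coordinate equations, a form
  that shows closedness.\<close>

lemma avoids_iff:
  "avoids x y \<longleftrightarrow> (\<forall>l. True \<in> set l \<longrightarrow> (\<exists>i<length l. y i = (\<not> l ! i)) \<or> x (to_nat l) = False)"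
proof (intro iffI allI impI)
  fix l :: "bool list" assume x: "avoids x y" and l: "True \<in> set l"
  show "(\<exists>i<length l. y i = (\<not> l ! i)) \<or> x (to_nat l) = False"
  proof (cases "l = map y [0..<length l]")
    case True
    from l obtain j where j: "j < length l" "l ! j" by (auto simp: in_set_conv_nth)
    have "l ! j = y j" using j(1) by (subst True) simp
    with j have "\<exists>j<length l. y j" by blast
    then have "to_nat (map y [0..<length l]) \<in> branch y" unfolding branch_def by blast
    then have "\<not> x (to_nat l)" using x unfolding avoids_def True[symmetric] by blast
    then show ?thesis by blast
  next
    case False
    then have "\<exists>i<length l. l ! i \<noteq> y i"
      unfolding list_eq_iff_nth_eq by simp
    then show ?thesis by auto
  qed
next
  assume *: "\<forall>l. True \<in> set l \<longrightarrow> (\<exists>i<length l. y i = (\<not> l ! i)) \<or> x (to_nat l) = False"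
  show "avoids x y"
    unfolding avoids_def
  proof
    fix m assume "m \<in> branch y"
    then obtain k j where m: "m = to_nat (map y [0..<k])" "j < k" "y j"
      unfolding branch_def by blast
    have "True \<in> set (map y [0..<k])"
      using image_eqI[of True y j "{0..<k}"] m(2,3) by simp
    moreover have "\<not> (\<exists>i<length (map y [0..<k]). y i = (\<not> map y [0..<k] ! i))" by auto
    ultimately have "x (to_nat (map y [0..<k])) = False"
      using *[THEN spec, of "map y [0..<k]"] by blast
    then show "\<not> x m" using m(1) by simp
  qed
qed

text \<open>Closedness jointly in both arguments lets a single compact set \<open>K\<close> of reals
  serve all \<open>y\<close> at once.\<close>

lemma closed_avoids: "closed {p. avoids (fst p) (snd p)}"
proof -
  have coord: "closed {p. h p i = c}" if "continuous_on UNIV h"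
    for h :: "(nat \<Rightarrow> bool) \<times> (nat \<Rightarrow> bool) \<Rightarrow> nat \<Rightarrow> bool" and i c
  proof (rule closed_Collect_eq)
    show "continuous_on UNIV (\<lambda>p. h p i)"
      using that by (rule continuous_on_product_then_coordinatewise)
  qed simp
  have eq: "{p. avoids (fst p) (snd p)} = (\<Inter>l\<in>{l. True \<in> set l}.
      (\<Union>i<length l. {p. snd p i = (\<not> l ! i)}) \<union> {p. fst p (to_nat l) = False})"
    by (auto simp: avoids_iff)
  have "closed (\<Union>i<length l. {p :: (nat \<Rightarrow> bool) \<times> (nat \<Rightarrow> bool). snd p i = (\<not> l ! i)})"
    for l :: "bool list"
    by (intro closed_UN ballI coord continuous_intros) simp
  moreover have "closed {p :: (nat \<Rightarrow> bool) \<times> (nat \<Rightarrow> bool). fst p (to_nat l) = False}"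
    for l :: "bool list"
    by (intro coord continuous_intros)
  ultimately show ?thesis unfolding eq
    by (intro closed_INT ballI closed_Un)
qed

lemma compact_avoids: "compact {x. avoids x y}"
proof -
  have "closed ((\<lambda>x. (x, y)) -` {p. avoids (fst p) (snd p)})"
    by (intro closed_vimage closed_avoids continuous_on_Pair continuous_on_id continuous_on_const)
  then have "closed {x. avoids x y}" by (simp add: vimage_def)
  from compact_Int_closed[OF compact_UNIV_Cantor this] show ?thesis by simp
qed

subsection \<open>The covers\<close>

text \<open>The map \<open>h\<close> carries the combinatorics of the Cantor space into another
  space. Only the trace of \<open>F y\<close> on the range of \<open>h\<close> is prescribed, which
  leaves freedom elsewhere.\<close>

lemma indecomposable_avoids_coverI:
  fixes h :: "(nat \<Rightarrow> bool) \<Rightarrow> 'x::topological_space"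
  assumes nonzero: "\<And>y. y \<in> Y \<Longrightarrow> \<exists>j. y j"
    and unsplit: "\<And>S. S \<subseteq> Y \<Longrightarrow> \<exists>x. \<kappa> \<le>o |{y \<in> Y. avoids x y}| \<and>
      ({y \<in> Y. avoids x y} \<subseteq> S \<or> {y \<in> Y. avoids x y} \<subseteq> Y - S)"
    and F_closed: "\<And>y. y \<in> Y \<Longrightarrow> closed (F y)"
    and F_iff: "\<And>x y. y \<in> Y \<Longrightarrow> h x \<in> F y \<longleftrightarrow> avoids x y"
    and T: "T = h ` {x. \<kappa> \<le>o |{y \<in> Y. avoids x y}|}"
    and E_closed: "\<And>E. E \<in> \<E> \<Longrightarrow> closed E"
    and E_T: "\<And>E. E \<in> \<E> \<Longrightarrow> E \<inter> T = {}"
    and E_large: "\<And>x. x \<notin> T \<Longrightarrow> \<kappa> \<le>o |{E \<in> \<E>. x \<in> E}|"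
  shows "indecomposable_closed_fold_cover \<kappa> (F ` Y \<union> \<E>)"
proof (rule indecomposable_closed_fold_coverI[where T = T])
  have trace: "{y \<in> Y. h x \<in> F y} = {y \<in> Y. avoids x y}" for x
    using F_iff by blast
  show "inj_on F Y"
  proof (rule inj_onI)
    fix y z assume yz: "y \<in> Y" "z \<in> Y" "F y = F z"
    then have "{x. avoids x y} = {x. avoids x z}" using F_iff by metis
    then show "y = z" by (rule inj_avoids[OF nonzero[OF yz(1)] nonzero[OF yz(2)]])
  qed
  show "\<kappa> \<le>o |{y \<in> Y. x \<in> F y}|" if "x \<in> T" for x
    using that trace by (auto simp: T)
  show "\<exists>x\<in>T. {y \<in> Y. x \<in> F y} \<subseteq> S \<or> {y \<in> Y. x \<in> F y} \<subseteq> Y - S" if S: "S \<subseteq> Y" for S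
  proof -
    obtain u where u: "\<kappa> \<le>o |{y \<in> Y. avoids u y}|"
      "{y \<in> Y. avoids u y} \<subseteq> S \<or> {y \<in> Y. avoids u y} \<subseteq> Y - S"
      using unsplit[OF S] by blast
    have "h u \<in> T" using u(1) by (simp add: T)
    then show ?thesis using u(2) unfolding trace[symmetric] by blast
  qed
qed (use F_closed E_closed E_T E_large in auto)

lemma continuum_ordLeqI:
  fixes \<kappa> :: "'k rel" and g :: "nat set \<Rightarrow> 'b"
  assumes "\<kappa> \<le>o |UNIV :: nat set set|" "inj g" "range g \<subseteq> B"
  shows "\<kappa> \<le>o |B|"
proof -
  have "|UNIV :: nat set set| \<le>o |B|"
    using assms(2,3) by (intro card_of_ordLeqI[of g]) auto
  then show ?thesis using assms(1) ordLeq_transitive by blast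
qed

section \<open>Covers of the two sequence spaces\<close>

lemma compact_imp_closed_fun:
  fixes S :: "('i \<Rightarrow> 'a::t2_space) set"
  assumes "compact S"
  shows "closed S"
proof -
  have "Hausdorff_space (product_topology (\<lambda>_ :: 'i. euclidean :: 'a topology) UNIV)"
    unfolding Hausdorff_space_product_topology
    by (simp add: Hausdorff_space_def disjnt_def) (metis hausdorff)
  then have "Hausdorff_space (euclidean :: ('i \<Rightarrow> 'a) topology)"
    unfolding euclidean_product_topology .
  then show ?thesis
    using compactin_imp_closedin[of euclidean S] assms by simp
qed

text \<open>The embedding puts an extra \<open>a\<close> in front, so the continuum many sequences
  \<open>g A\<close>, which start with \<open>b\<close>, lie outside \<open>T\<close>. Pairing them
  with a point outside \<open>T\<close> gives enough closed sets through that point.\<close>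

lemma indecomposable_cover_sequence_space:
  fixes a b :: "'a::t2_space"
  assumes ab: "a \<noteq> b" and le: "\<kappa> \<le>o |UNIV :: nat set set|"
    and nonzero: "\<And>y. y \<in> Y \<Longrightarrow> \<exists>j. y j"
    and unsplit: "\<And>S. S \<subseteq> Y \<Longrightarrow> \<exists>x. \<kappa> \<le>o |{y \<in> Y. avoids x y}| \<and>
      ({y \<in> Y. avoids x y} \<subseteq> S \<or> {y \<in> Y. avoids x y} \<subseteq> Y - S)"
  shows "\<exists>\<H> :: (nat \<Rightarrow> 'a) set set. indecomposable_closed_fold_cover \<kappa> \<H>"
proof -
  define h where "h x = (\<lambda>n. if n = 0 then a else if x (n - 1) then b else a)"
    for x :: "nat \<Rightarrow> bool"
  define T where "T = h ` {x. \<kappa> \<le>o |{y \<in> Y. avoids x y}|}"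
  define \<E> where "\<E> = {{z, w} | z w. z \<notin> T \<and> w \<notin> T}"
  have inj: "inj h"
  proof (rule injI, rule ext)
    fix x y :: "nat \<Rightarrow> bool" and i
    assume "h x = h y"
    then have "h x (Suc i) = h y (Suc i)" by simp
    then show "x i = y i" using ab by (simp add: h_def split: if_splits)
  qed
  have cont: "continuous_on UNIV h"
  proof (rule continuous_on_coordinatewise_then_product)
    show "continuous_on UNIV (\<lambda>x. h x i)" for i
      using continuous_on_coordinate[of "\<lambda>c. if c then b else a" "i - 1"]
      by (cases "i = 0") (simp_all add: h_def)
  qed
  have "indecomposable_closed_fold_cover \<kappa> ((\<lambda>y. h ` {x. avoids x y}) ` Y \<union> \<E>)"
  proof (rule indecomposable_avoids_coverI[OF nonzero unsplit, where h = h])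
    show "closed (h ` {x. avoids x y})" for y
      by (intro compact_imp_closed_fun compact_continuous_image compact_avoids
          continuous_on_subset[OF cont]) simp
    show "h x \<in> h ` {x. avoids x y} \<longleftrightarrow> avoids x y" for x y
      using inj by (simp add: inj_image_mem_iff)
    show "closed E" if "E \<in> \<E>" for E
      using that unfolding \<E>_def by (auto intro!: compact_imp_closed_fun finite_imp_compact)
    show "E \<inter> T = {}" if "E \<in> \<E>" for E using that unfolding \<E>_def by auto
    fix x assume x: "x \<notin> T"
    define g where "g A = (\<lambda>n. if n = 0 \<or> n - 1 \<in> A then b else a)" for A :: "nat set"
    have gT: "g A \<notin> T" for A
    proof
      assume "g A \<in> T"
      then obtain u where "g A = h u" by (auto simp: T_def)
      then have "g A 0 = h u 0" by simp
      then show False using ab by (simp add: g_def h_def)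
    qed
    show "\<kappa> \<le>o |{E \<in> \<E>. x \<in> E}|"
    proof (rule continuum_ordLeqI[OF le, of "\<lambda>A. {x, g A}"])
      show "inj (\<lambda>A. {x, g A})"
      proof (rule injI, rule set_eqI)
        fix A B :: "nat set" and i
        assume "{x, g A} = {x, g B}"
        then have "g A (Suc i) = g B (Suc i)" by (auto simp: doubleton_eq_iff)
        then show "i \<in> A \<longleftrightarrow> i \<in> B" using ab by (simp add: g_def split: if_splits)
      qed
      show "range (\<lambda>A. {x, g A}) \<subseteq> {E \<in> \<E>. x \<in> E}"
        using x gT unfolding \<E>_def by auto
    qed
  qed (use T_def in simp_all)
  then show ?thesis by blast
qed

section \<open>Covers of the real line by translates of one compact set\<close>

lemma translate_compact_eqD:
  fixes K :: "real set"
  assumes "compact K" "K \<noteq> {}" "(\<lambda>x. x + s) ` K = (\<lambda>x. x + t) ` K"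
  shows "s = t"
proof -
  \<comment> \<open>Equal translates have equal maxima, which determines the shift.\<close>
  obtain m where m: "m \<in> K" "\<And>x. x \<in> K \<Longrightarrow> x \<le> m"
    using compact_attains_sup[OF assms(1,2)] by blast
  have "m + s \<in> (\<lambda>x. x + t) ` K" "m + t \<in> (\<lambda>x. x + s) ` K"
    using m(1) assms(3) by auto
  then obtain k l where "k \<in> K" "m + s = k + t" "l \<in> K" "m + t = l + s" by auto
  then show ?thesis using m(2)[of k] m(2)[of l] by linarith
qed

lemma indecomposable_cover_real_translates:
  fixes \<kappa> :: "'k rel"
  assumes le: "\<kappa> \<le>o |UNIV :: nat set set|"
    and nonzero: "\<And>y. y \<in> Y \<Longrightarrow> \<exists>j. y j"
    and unsplit: "\<And>S. S \<subseteq> Y \<Longrightarrow> \<exists>x. \<kappa> \<le>o |{y \<in> Y. avoids x y}| \<and>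
      ({y \<in> Y. avoids x y} \<subseteq> S \<or> {y \<in> Y. avoids x y} \<subseteq> Y - S)"
  shows "\<exists>(\<H> :: real set set) K. indecomposable_closed_fold_cover \<kappa> \<H> \<and>
    compact K \<and> (\<forall>H\<in>\<H>. \<exists>t. H = (\<lambda>x. x + t) ` K)"
proof -
  txt \<open>
    \<open>K + 4 * expand y\<close> meets the range of \<open>expand\<close> exactly in the points \<open>expand x\<close> with
    \<open>avoids x y\<close>.  The second part of \<open>K\<close> serves the points outside \<open>T\<close>: it provides continuum
    many translates of \<open>K\<close> through such a point that miss \<open>T\<close>.  The factors 1, 4, 16 keep the
    bits of the summands apart in the base 64 digits of a sum.
  \<close>
  define K where "K = (\<lambda>p. expand (fst p) - 4 * expand (snd p)) ` {p. avoids (fst p) (snd p)} \<union>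
    range (\<lambda>w. - 16 * expand w)"
  define F where "F y = (\<lambda>x. x + 4 * expand y) ` K" for y
  define T where "T = expand ` {x. \<kappa> \<le>o |{y \<in> Y. avoids x y}|}"
  define \<E> where "\<E> = {(\<lambda>x. x + t) ` K | t. (\<lambda>x. x + t) ` K \<inter> T = {}}"
  have bit: "0 \<le> (of_bool b :: int)" "of_bool b \<le> (1 :: int)" for b by simp_all
  have K: "compact K"
    unfolding K_def
  proof (intro compact_Un compact_continuous_image)
    have "compact (UNIV \<inter> {p :: (nat \<Rightarrow> bool) \<times> (nat \<Rightarrow> bool). avoids (fst p) (snd p)})"
      using compact_Times[OF compact_UNIV_Cantor compact_UNIV_Cantor]
      by (intro compact_Int_closed closed_avoids) simp
    then show "compact {p :: (nat \<Rightarrow> bool) \<times> (nat \<Rightarrow> bool). avoids (fst p) (snd p)}" by simp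
    show "continuous_on {p. avoids (fst p) (snd p)} (\<lambda>p. expand (fst p) - 4 * expand (snd p))"
      by (intro continuous_intros continuous_on_compose2[OF continuous_on_expand]) auto
    show "continuous_on UNIV (\<lambda>w. - 16 * expand w)"
      by (intro continuous_intros continuous_on_expand)
  qed (rule compact_UNIV_Cantor)
  have K_ne: "K \<noteq> {}" by (auto simp: K_def)
  have K_closed: "closed ((\<lambda>x. x + t) ` K)" for t
    using K by (intro compact_imp_closed compact_continuous_image continuous_intros)
  \<comment> \<open>Absent summands are written as the zero sequence, so that both parts of
    \<open>K\<close> have one form to which the digit comparison applies.\<close>
  have K_cases: "\<exists>u y v. k = expand u - 4 * expand y - 16 * expand v \<and>
      (avoids u y \<and> v = (\<lambda>_. False) \<or> u = (\<lambda>_. False) \<and> y = (\<lambda>_. False))"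
    if "k \<in> K" for k
  proof -
    from that consider u y where "avoids u y" "k = expand u - 4 * expand y"
      | v where "k = - 16 * expand v" by (auto simp: K_def)
    then show ?thesis
    proof cases
      case 1
      then show ?thesis
        by (intro exI[of _ u] exI[of _ y] exI[of _ "\<lambda>_. False"]) simp
    next
      case 2
      then show ?thesis
        by (intro exI[of _ "\<lambda>_. False"] exI[of _ v]) simp
    qed
  qed
  have F_iff: "expand x \<in> F y \<longleftrightarrow> avoids x y" if y: "y \<in> Y" for x y
  proof
    assume "avoids x y"
    then have "expand x - 4 * expand y \<in> K"
      unfolding K_def by (intro UnI1 image_eqI[of _ _ "(x, y)"]) simp_all
    then have "(expand x - 4 * expand y) + 4 * expand y \<in> F y" unfolding F_def by (rule imageI)
    then show "expand x \<in> F y" by simp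
  next
    assume "expand x \<in> F y"
    then obtain k where k: "k \<in> K" "expand x = k + 4 * expand y" unfolding F_def by blast
    then obtain u z v where uzv: "k = expand u - 4 * expand z - 16 * expand v"
      "avoids u z \<and> v = (\<lambda>_. False) \<or> u = (\<lambda>_. False) \<and> z = (\<lambda>_. False)"
      using K_cases by blast
    have *: "of_bool (x i) + 4 * of_bool (z i) + 16 * of_bool (v i) =
        (of_bool (u i) + 4 * of_bool (y i) :: int)" for i
      using expand_combination_digits[of x "\<lambda>_. False" z v "\<lambda>_. False"
          u "\<lambda>_. False" y "\<lambda>_. False" "\<lambda>_. False" i] k(2) uzv(1) by simp
    have digits: "x i = u i" "z i = y i" for i
      using *[of i] by (simp_all add: of_bool_def split: if_splits)
    then have "x = u" "z = y" by (simp_all add: fun_eq_iff)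
    \<comment> \<open>Members of \<open>Y\<close> are not the zero sequence, so \<open>k\<close>
      belongs to the first part of \<open>K\<close>.\<close>
    moreover have "z \<noteq> (\<lambda>_. False)" using nonzero[OF y] \<open>z = y\<close> by auto
    ultimately show "avoids x y" using uzv(2) by simp
  qed
  have "indecomposable_closed_fold_cover \<kappa> (F ` Y \<union> \<E>)"
  proof (rule indecomposable_avoids_coverI[OF nonzero unsplit _ F_iff T_def])
    show "closed (F y)" for y unfolding F_def by (rule K_closed)
    show "closed E" if "E \<in> \<E>" for E using that K_closed unfolding \<E>_def by blast
    show "E \<inter> T = {}" if "E \<in> \<E>" for E using that unfolding \<E>_def by blast
    fix x assume x: "x \<notin> T"
    \<comment> \<open>The shift moves the point \<open>- 16 * expand w\<close> of \<open>K\<close>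
      to \<open>x\<close>.\<close>
    define D where "D w = (\<lambda>k. k + (x + 16 * expand w)) ` K" for w
    \<comment> \<open>The set \<open>A\<close> is coded from place 2 on. The fixed bits at 0 and 1
      meet the hypotheses of \<open>good\<close>, and bit 0 later tells \<open>s A\<close> from its
      complement.\<close>
    define s where "s A i \<longleftrightarrow> i = 1 \<or> (2 \<le> i \<and> i - 2 \<in> A)" for A :: "nat set" and i :: nat
    have bad: "\<exists>p u y v. expand p \<in> T \<and>
        x = expand p - expand u + 4 * expand y + 16 * expand v - 16 * expand w \<and>
        (v = (\<lambda>_. False) \<or> u = (\<lambda>_. False) \<and> y = (\<lambda>_. False))"
      if meets: "D w \<inter> T \<noteq> {}" for w
    proof -
      obtain k where k: "k \<in> K" "k + (x + 16 * expand w) \<in> T"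
        using meets unfolding D_def by blast
      then obtain p where p: "k + (x + 16 * expand w) = expand p" by (auto simp: T_def)
      obtain u y v where uyv: "k = expand u - 4 * expand y - 16 * expand v"
        "v = (\<lambda>_. False) \<or> u = (\<lambda>_. False) \<and> y = (\<lambda>_. False)"
        using K_cases[OF k(1)] by blast
      have "x = expand p - expand u + 4 * expand y + 16 * expand v - 16 * expand w"
        using p uyv(1) by linarith
      then show ?thesis using k(2) uyv(2) unfolding p by blast
    qed
    txt \<open>
      If both translates met \<open>T\<close>, comparing the digits of the two resulting expressions for \<open>x\<close>
      would force \<open>v = w\<close> and hence \<open>x = expand p \<in> T\<close>.
    \<close>
    have good: "D w \<inter> T = {} \<or> D (\<lambda>i. \<not> w i) \<inter> T = {}" if w: "\<not> w 0" "w 1" for w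
    proof (rule ccontr)
      assume "\<not> ?thesis"
      then have bad1: "D w \<inter> T \<noteq> {}" and bad2: "D (\<lambda>i. \<not> w i) \<inter> T \<noteq> {}" by auto
      obtain p u y v where 1: "expand p \<in> T"
        "x = expand p - expand u + 4 * expand y + 16 * expand v - 16 * expand w"
        "v = (\<lambda>_. False) \<or> u = (\<lambda>_. False) \<and> y = (\<lambda>_. False)"
        using bad[OF bad1] by blast
      obtain p' u' y' v' where 2: "expand p' \<in> T"
        "x = expand p' - expand u' + 4 * expand y' + 16 * expand v' - 16 * expand (\<lambda>i. \<not> w i)"
        "v' = (\<lambda>_. False) \<or> u' = (\<lambda>_. False) \<and> y' = (\<lambda>_. False)"
        using bad[OF bad2] by blast
      have digit: "of_bool (p i) - of_bool (u i) + 4 * of_bool (y i) + 16 * of_bool (v i) - 16 * of_bool (w i) =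
          (of_bool (p' i) - of_bool (u' i) + 4 * of_bool (y' i) + 16 * of_bool (v' i) - 16 * of_bool (\<not> w i) :: int)"
        for i
        by (rule expand_combination_digits) (use 1(2) 2(2) in simp)
      have d0: "of_bool (p 0) - of_bool (u 0) + 4 * of_bool (y 0) + 16 * of_bool (v 0) =
          (of_bool (p' 0) - of_bool (u' 0) + 4 * of_bool (y' 0) + 16 * of_bool (v' 0) - 16 :: int)"
        and d1: "of_bool (p 1) - of_bool (u 1) + 4 * of_bool (y 1) + 16 * of_bool (v 1) - 16 =
          (of_bool (p' 1) - of_bool (u' 1) + 4 * of_bool (y' 1) + 16 * of_bool (v' 1) :: int)"
        using digit[of 0] digit[of 1] w by simp_all
      note bits = bit[of "p 0"] bit[of "u 0"] bit[of "y 0"] bit[of "p' 0"] bit[of "u' 0"] bit[of "y' 0"]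
        bit[of "p 1"] bit[of "u 1"] bit[of "y 1"] bit[of "p' 1"] bit[of "u' 1"] bit[of "y' 1"]
        bit[of "v 0"] bit[of "v' 0"] bit[of "v 1"] bit[of "v' 1"]
      \<comment> \<open>If \<open>v\<close> were zero, place 0 would force \<open>v' 0\<close>,
        hence \<open>u'\<close> would be zero; at place 1 the left side would then be negative and
        the right side not. The argument for \<open>v'\<close> exchanges the two places.\<close>
      have "v \<noteq> (\<lambda>_. False)"
      proof
        assume "v = (\<lambda>_. False)"
        then have v0: "of_bool (v 0) = (0 :: int)" "of_bool (v 1) = (0 :: int)" by simp_all
        then have "of_bool (v' 0) \<noteq> (0 :: int)" using d0 bits by linarith
        then have "u' = (\<lambda>_. False)" using 2(3) by auto
        then have "of_bool (u' 1) = (0 :: int)" by simp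
        then show False using d1 bits v0 by linarith
      qed
      moreover have "v' \<noteq> (\<lambda>_. False)"
      proof
        assume "v' = (\<lambda>_. False)"
        then have v0: "of_bool (v' 0) = (0 :: int)" "of_bool (v' 1) = (0 :: int)" by simp_all
        then have "of_bool (v 1) \<noteq> (0 :: int)" using d1 bits by linarith
        then have "u = (\<lambda>_. False)" using 1(3) by auto
        then have "of_bool (u 0) = (0 :: int)" by simp
        then show False using d0 bits v0 by linarith
      qed
      ultimately have zero: "u = (\<lambda>_. False)" "y = (\<lambda>_. False)" "u' = (\<lambda>_. False)" "y' = (\<lambda>_. False)"
        using 1(3) 2(3) by blast+
      \<comment> \<open>What remains equates a difference of two bits with a multiple of 16, so both
        vanish and \<open>v i - v' i = 2 * w i - 1\<close> as integers.\<close>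
      have "v i = w i" for i
      proof -
        have "of_bool (p i) + 16 * of_bool (v i) - 16 * of_bool (w i) =
            (of_bool (p' i) + 16 * of_bool (v' i) - 16 * of_bool (\<not> w i) :: int)"
          using digit[of i] unfolding zero by simp
        then show ?thesis
          by (cases "w i"; cases "v i"; cases "v' i"; cases "p i"; cases "p' i") simp_all
      qed
      then have "v = w" by (rule ext)
      then have "x = expand p" using 1(2) unfolding zero by simp
      then show False using 1(1) x by blast
    qed
    define c where "c A = (if D (s A) \<inter> T = {} then s A else (\<lambda>i. \<not> s A i))" for A
    have s01: "\<not> s A 0" "s A 1" for A by (simp_all add: s_def)
    have c_good: "D (c A) \<inter> T = {}" for A
    proof (cases "D (s A) \<inter> T = {}")
      case True
      then have "c A = s A" by (simp add: c_def)
      with True show ?thesis by simp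
    next
      case False
      then have "c A = (\<lambda>i. \<not> s A i)" by (simp add: c_def)
      with False show ?thesis using good[of "s A", OF s01] by simp
    qed
    have inj_c: "inj c"
    proof (rule injI, rule set_eqI)
      fix A B i assume eq: "c A = c B"
      \<comment> \<open>Equality at place 0 shows that both sets made the same choice between
        \<open>s\<close> and its complement.\<close>
      have "c A 0 = c B 0" "c A (i + 2) = c B (i + 2)" using eq by simp_all
      moreover have "c A = s A \<or> c A = (\<lambda>i. \<not> s A i)" "c B = s B \<or> c B = (\<lambda>i. \<not> s B i)"
        by (simp_all add: c_def)
      ultimately have "s A (i + 2) = s B (i + 2)" using s01[of A] s01[of B] by metis
      then show "i \<in> A \<longleftrightarrow> i \<in> B" by (simp add: s_def)
    qed
    show "\<kappa> \<le>o |{E \<in> \<E>. x \<in> E}|"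
    proof (rule continuum_ordLeqI[OF le, of "\<lambda>A. D (c A)"])
      show "inj (\<lambda>A. D (c A))"
      proof (rule injI)
        fix A B assume "D (c A) = D (c B)"
        then have "x + 16 * expand (c A) = x + 16 * expand (c B)"
          unfolding D_def by (rule translate_compact_eqD[OF K K_ne])
        then show "A = B" using inj_expand inj_c by (simp add: inj_eq)
      qed
      have "x \<in> D w" for w
      proof -
        have "- 16 * expand w \<in> K" by (simp add: K_def)
        then show ?thesis unfolding D_def by (intro image_eqI[of _ _ "- 16 * expand w"]) simp_all
      qed
      moreover have "D w \<in> \<E>" if "D w \<inter> T = {}" for w
        using that unfolding D_def \<E>_def by blast
      ultimately show "range (\<lambda>A. D (c A)) \<subseteq> {E \<in> \<E>. x \<in> E}" using c_good by blast
    qed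
  qed
  moreover have "\<exists>t. H = (\<lambda>x. x + t) ` K" if "H \<in> F ` Y \<union> \<E>" for H
    using that unfolding F_def \<E>_def by blast
  ultimately show ?thesis using K by blast
qed

theorem theorem6p1:
  fixes \<kappa> :: "'k rel"
  assumes "Card_order \<kappa>" and "natLeq \<le>o \<kappa>" and "\<kappa> <o |UNIV :: nat set set|"
    and "MA_sigma_centered \<kappa> TYPE(nat set)"
  shows "(\<exists>\<H> :: real set set. indecomposable_closed_fold_cover \<kappa> \<H>) \<and>
         (\<exists>\<H> :: (nat \<Rightarrow> nat) set set. indecomposable_closed_fold_cover \<kappa> \<H>) \<and>
         (\<exists>\<H> :: (nat \<Rightarrow> bool) set set. indecomposable_closed_fold_cover \<kappa> \<H>) \<and>
         (\<exists>(\<H> :: real set set) K. indecomposable_closed_fold_cover \<kappa> \<H> \<and>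
            compact K \<and> (\<forall>H\<in>\<H>. \<exists>t. H = (\<lambda>x. x + t) ` K))"
proof -
  have le: "\<kappa> \<le>o |UNIV :: nat set set|" using assms(3) ordLess_imp_ordLeq by blast
  show ?thesis
  proof (rule MA_avoids_unsplittable[OF assms(1,2) le assms(4)])
    fix Y
    assume nonzero: "\<And>y. y \<in> Y \<Longrightarrow> \<exists>j. y j"
      and unsplit: "\<And>S. S \<subseteq> Y \<Longrightarrow> \<exists>x. \<kappa> \<le>o |{y \<in> Y. avoids x y}| \<and>
        ({y \<in> Y. avoids x y} \<subseteq> S \<or> {y \<in> Y. avoids x y} \<subseteq> Y - S)"
    have real: "\<exists>(\<H> :: real set set) K. indecomposable_closed_fold_cover \<kappa> \<H> \<and>
        compact K \<and> (\<forall>H\<in>\<H>. \<exists>t. H = (\<lambda>x. x + t) ` K)"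
      by (rule indecomposable_cover_real_translates[OF le nonzero unsplit])
    moreover have "\<exists>\<H> :: (nat \<Rightarrow> nat) set set. indecomposable_closed_fold_cover \<kappa> \<H>"
      by (rule indecomposable_cover_sequence_space[of 0 "1 :: nat", OF _ le nonzero unsplit]) simp
    moreover have "\<exists>\<H> :: (nat \<Rightarrow> bool) set set. indecomposable_closed_fold_cover \<kappa> \<H>"
      by (rule indecomposable_cover_sequence_space[of False True, OF _ le nonzero unsplit]) simp
    moreover from real have "\<exists>\<H> :: real set set. indecomposable_closed_fold_cover \<kappa> \<H>"
      by (elim exE conjE) (rule exI)
    ultimately show ?thesis by (intro conjI)
  qed
qed

end
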